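(* Let $\tau>0$ and let $u^{\varepsilon,n}_{\gamma}$ be the numerical solution at time $\hat t_n$. Consider one step of the semi-discrete IMEX relaxation Runge–Kutta scheme for the energy regularized logarithmic Schrödinger equation, $$ \begin{cases} u^\varepsilon_{i}=u^{\varepsilon,n}_{\gamma}+\tau\sum_{j=1}^{i}a^{I}_{ij}g^{I}_{j}+\tau\sum_{j=1}^{i-1}a^{E}_{ij}g^{E}_{j},\quad i=1,\ldots,s,\\[4pt] u^{\varepsilon,n+1}_{\gamma}=u^{\varepsilon,n}_{\gamma}+\tau\gamma_{n}\sum_{j=1}^{s}b^{I}_{j}g^{I}_{j}+\tau\gamma_{n}\sum_{j=1}^{s}b^{E}_{j}g^{E}_{j}, \end{cases} $$ where $g^I_j=g^I(u^\varepsilon_j)$ and $g^E_j=g^E(u^\varepsilon_j)$. If the relaxation coefficient is set to $$ \gamma_{n}=\begin{cases} 1, & \text{if } \sum_{j=1}^{s}b^{I}_{j}g^{I}_{j}+\sum_{j=1}^{s}b^{E}_{j}g^{E}_{j}=0,\\[6pt] \dfrac{-2\sum_{j=1}^{s}\operatorname{Re}\big(b^{I}_{j}g^{I}_{j}+b^{E}_{j}g^{E}_{j},\,u^{\varepsilon,n}_{\gamma}\big)}{\tau\big\|\sum_{j=1}^{s}b^{I}_{j}g^{I}_{j}+\sum_{j=1}^{s}b^{E}_{j}g^{E}_{j}\big\|^2}, & \text{if } \sum_{j=1}^{s}b^{I}_{j}g^{I}_{j}+\sum_{j=1}^{s}b^{E}_{j}g^{E}_{j}\neq 0, \end{cases}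 $$ then the scheme conserves mass: $$\|u^{\varepsilon,n+1}_{\gamma}\|^{2}=\|u^{\varepsilon,n}_{\gamma}\|^{2}.$$
   Context: Let $\Omega\subset\mathbb R^d$ ($d\ge 1$) be a bounded domain with smooth boundary, $\lambda\in\mathbb R\setminus\{0\}$, $0<\varepsilon\ll 1$, and $k\ge 2$ an integer. $(\cdot,\cdot)$ and $\|\cdot\|$ denote the inner product and norm of the complex space $L^2(\Omega)$, $(u,v)=\int_\Omega u\,\overline{v}\,dx$; the initial value, stages, and values $g^I_j,g^E_j$ are understood to lie in $L^2(\Omega)$. The energy regularized logarithmic Schrödinger equation (ERLogSE) is $\mathrm{i}\,\partial_t u^\varepsilon+\Delta u^\varepsilon=\lambda u^\varepsilon f^\varepsilon_k(|u^\varepsilon|^2)$, with initial condition $u^\varepsilon(x,0)=u_0(x)$, where for $\rho\ge 0$ $$f_k^\varepsilon(\rho)=\begin{cases}\ln\rho, & \rho\ge\varepsilon^2,\\ \ln(\varepsilon^2)-\frac{k+1}{k}\big(1-\frac{\rho}{\varepsilon^2}\big)^k-\sum_{j=1}^{k-1}\frac1j\big(1-\frac{\rho}{\varepsilon^2}\big)^j, & \rho<\varepsilon^2.\end{cases}$$ It is written as $u^\varepsilon_t=g^I(u^\varepsilon)+g^E(u^\varepsilon)$ with $g^I(u)=\mathrm{i}\Delta u$ and $g^E(u)=-\mathrm{i}\lambda u f_k^\varepsilon(|u|^2)$. An $s$-stage implicit-explicit (IMEX) Runge–Kutta method is given by real coefficients $A^I=(a^I_{ij})_{s\times s}$ with $a^I_{ij}=0$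 for $j>i$, $A^E=(a^E_{ij})_{s\times s}$ with $a^E_{ij}=0$ for $j\ge i$, and weights $b^I,b^E\in\mathbb R^s$. The value $u^{\varepsilon,n+1}_\gamma$ approximates the solution at time $\hat t_{n+1}=\hat t_n+\gamma_n\tau$. *)

theory Defs
  imports "HOL-Analysis.Analysis"
begin

section \<open>Smooth functions and smooth bounded domains\<close>

(* For an open set S in a finite-dimensional space: f is C^m on S if all its iterated
   directional derivatives of order at most m exist and are continuous on S. *)
primrec Ck_on ::
  "nat \<Rightarrow> 'a::real_normed_vector set \<Rightarrow> ('a \<Rightarrow> 'b::real_normed_vector) \<Rightarrow> bool" where
  "Ck_on 0 S f \<longleftrightarrow> continuous_on S f"
| "Ck_on (Suc m) S f \<longleftrightarrow>
     (\<forall>x\<in>S. f differentiable (at x)) \<and>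
     (\<forall>v. Ck_on m S (\<lambda>x. frechet_derivative f (at x) v))"

definition smooth_on ::
  "'a::real_normed_vector set \<Rightarrow> ('a \<Rightarrow> 'b::real_normed_vector) \<Rightarrow> bool" where
  "smooth_on S f \<longleftrightarrow> (\<forall>m. Ck_on m S f)"

(* Near each boundary point the set is a sublevel set of a smooth function without critical
   points; in particular it lies locally on one side of its boundary. *)
definition smooth_boundary :: "(real^'d::finite) set \<Rightarrow> bool" where
  "smooth_boundary \<Omega> \<longleftrightarrow>
     (\<forall>p\<in>frontier \<Omega>. \<exists>U (\<psi> :: real^'d \<Rightarrow> real).
        open U \<and> p \<in> U \<and> smooth_on U \<psi> \<and>
        (\<forall>x\<in>U. \<exists>v. frechet_derivative \<psi> (at x) v \<noteq> 0) \<and>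
        \<Omega> \<inter> U = {x \<in> U. \<psi> x < 0})"

definition smooth_bounded_domain :: "(real^'d::finite) set \<Rightarrow> bool" where
  "smooth_bounded_domain \<Omega> \<longleftrightarrow>
     \<Omega> \<noteq> {} \<and> open \<Omega> \<and> connected \<Omega> \<and> bounded \<Omega> \<and> smooth_boundary \<Omega>"

section \<open>The complex space L2 of a set\<close>

(* Elements of L2 are represented by functions; equality in L2 is eq_L2. Values outside
   the set are irrelevant. *)
definition L2 :: "(real^'d::finite) set \<Rightarrow> (real^'d \<Rightarrow> complex) set" where
  "L2 \<Omega> = {u. u \<in> borel_measurable (lebesgue_on \<Omega>) \<and>
              integrable (lebesgue_on \<Omega>) (\<lambda>x. (cmod (u x))\<^sup>2)}"

definition eq_L2 ::
  "(real^'d::finite) set \<Rightarrow> (real^'d \<Rightarrow> complex) \<Rightarrow> (real^'d \<Rightarrow> complex) \<Rightarrow> bool" where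
  "eq_L2 \<Omega> u v \<longleftrightarrow> (AE x in lebesgue_on \<Omega>. u x = v x)"

definition inner_L2 ::
  "(real^'d::finite) set \<Rightarrow> (real^'d \<Rightarrow> complex) \<Rightarrow> (real^'d \<Rightarrow> complex) \<Rightarrow> complex" where
  "inner_L2 \<Omega> u v = (LINT x|lebesgue_on \<Omega>. u x * cnj (v x))"

definition norm_L2 :: "(real^'d::finite) set \<Rightarrow> (real^'d \<Rightarrow> complex) \<Rightarrow> real" where
  "norm_L2 \<Omega> u = sqrt (LINT x|lebesgue_on \<Omega>. (cmod (u x))\<^sup>2)"

section \<open>The Laplacian on L2\<close>

definition laplacian :: "(real^'d::finite \<Rightarrow> real) \<Rightarrow> real^'d \<Rightarrow> real" where
  "laplacian \<phi> x =
     (\<Sum>i\<in>UNIV. frechet_derivative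
        (\<lambda>y. frechet_derivative \<phi> (at y) (axis i 1)) (at x) (axis i 1))"

definition test_function :: "(real^'d::finite) set \<Rightarrow> (real^'d \<Rightarrow> real) \<Rightarrow> bool" where
  "test_function \<Omega> \<phi> \<longleftrightarrow>
     smooth_on UNIV \<phi> \<and> (\<exists>K. compact K \<and> K \<subseteq> \<Omega> \<and> (\<forall>x. x \<notin> K \<longrightarrow> \<phi> x = 0))"

(* The distributional Laplacian of u is the L2 function w. Real test functions suffice
   by linearity. *)
definition has_laplacian_L2 ::
  "(real^'d::finite) set \<Rightarrow> (real^'d \<Rightarrow> complex) \<Rightarrow> (real^'d \<Rightarrow> complex) \<Rightarrow> bool" where
  "has_laplacian_L2 \<Omega> u w \<longleftrightarrow> u \<in> L2 \<Omega> \<and> w \<in> L2 \<Omega> \<and>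
     (\<forall>\<phi>. test_function \<Omega> \<phi> \<longrightarrow>
        (LINT x|lebesgue_on \<Omega>. laplacian \<phi> x *\<^sub>R u x) =
        (LINT x|lebesgue_on \<Omega>. \<phi> x *\<^sub>R w x))"

section \<open>The energy regularized logarithmic Schroedinger equation\<close>

definition f_reg :: "real \<Rightarrow> nat \<Rightarrow> real \<Rightarrow> real" where
  "f_reg \<epsilon> k \<rho> =
     (if \<rho> \<ge> \<epsilon>\<^sup>2 then ln \<rho>
      else ln (\<epsilon>\<^sup>2) - (real k + 1) / real k * (1 - \<rho> / \<epsilon>\<^sup>2) ^ k
           - (\<Sum>j=1..k-1. 1 / real j * (1 - \<rho> / \<epsilon>\<^sup>2) ^ j))"

(* g = i Laplacian u, as a relation because the Laplacian is only determined almost everywhere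
   and only exists for some u. *)
definition is_gI ::
  "(real^'d::finite) set \<Rightarrow> (real^'d \<Rightarrow> complex) \<Rightarrow> (real^'d \<Rightarrow> complex) \<Rightarrow> bool" where
  "is_gI \<Omega> u g \<longleftrightarrow> (\<exists>w. has_laplacian_L2 \<Omega> u w \<and> eq_L2 \<Omega> g (\<lambda>x. \<i> * w x))"

definition gE_fun ::
  "real \<Rightarrow> real \<Rightarrow> nat \<Rightarrow> (real^'d::finite \<Rightarrow> complex) \<Rightarrow> real^'d \<Rightarrow> complex" where
  "gE_fun lam \<epsilon> k u x =
     - \<i> * complex_of_real lam * u x * complex_of_real (f_reg \<epsilon> k ((cmod (u x))\<^sup>2))"

end

theory Submission
  imports Defs
begin

text \<open>
  The proof is one identity in the real Hilbert space underlying \<open>L2 \<Omega>\<close>. With \<open>c = \<tau> * \<gamma>\<close> the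
  update reads \<open>un1 = un + c G\<close> almost everywhere, so the polarization identity gives
  \<open>norm un1 ^ 2 = norm un ^ 2 + c (2 S + c N)\<close>, where \<open>S = Re (G, un)\<close> and \<open>N = norm G ^ 2\<close>.
  The change of mass is thus a quadratic polynomial in the step length \<open>c\<close> along the direction
  \<open>G\<close>, and the relaxation coefficient selects its root \<open>c = - 2 S / N\<close>. If \<open>G\<close> vanishes, then
  \<open>N = 0\<close> and there is nothing to select, but then \<open>un1 = un\<close> for any \<open>\<gamma>\<close>.

  The polarization identity is \<open>norm_L2_add_scaleR_square\<close>; it needs square integrability of
  \<open>G\<close>, which follows from that of the stage values. Two facts tie the identity to the
  almost-everywhere formulation: the norm depends only on the class of a function
  (\<open>norm_L2_cong\<close>), and \<open>N\<close> vanishes exactly when \<open>G\<close> does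
  (\<open>norm_L2_square_eq_0_iff\<close>), which makes the division by \<open>N\<close> legitimate.
\<close>

lemma L2_D:
  assumes "u \<in> L2 \<Omega>"
  shows "u \<in> borel_measurable (lebesgue_on \<Omega>)"
    and "integrable (lebesgue_on \<Omega>) (\<lambda>x. (cmod (u x))\<^sup>2)"
  using assms by (auto simp: L2_def)

text \<open>
  By \<open>2 |u| |v| \<le> |u|^2 + |v|^2\<close>, so that the inner product is a convergent integral.
\<close>

lemma integrable_mult_cnj:
  assumes u: "u \<in> L2 \<Omega>" and v: "v \<in> L2 \<Omega>"
  shows "integrable (lebesgue_on \<Omega>) (\<lambda>x. u x * cnj (v x))"
proof (rule Bochner_Integration.integrable_bound)
  show "integrable (lebesgue_on \<Omega>) (\<lambda>x. (cmod (u x))\<^sup>2 + (cmod (v x))\<^sup>2)"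
    using L2_D[OF u] L2_D[OF v] by simp
  have "(\<lambda>x. cnj (v x)) \<in> borel_measurable (lebesgue_on \<Omega>)"
    using L2_D(1)[OF v] by (rule borel_measurable_continuous_on[rotated]) (intro continuous_intros)
  then show "(\<lambda>x. u x * cnj (v x)) \<in> borel_measurable (lebesgue_on \<Omega>)"
    using L2_D(1)[OF u] by simp
  have "a * b \<le> a\<^sup>2 + b\<^sup>2" if "0 \<le> a" "0 \<le> b" for a b :: real
    using sum_squares_bound[of a b] mult_nonneg_nonneg[OF that] by linarith
  then show "AE x in lebesgue_on \<Omega>.
      norm (u x * cnj (v x)) \<le> norm ((cmod (u x))\<^sup>2 + (cmod (v x))\<^sup>2)"
    by (intro AE_I2) (simp add: norm_mult)
qed

lemma L2_zero: "(\<lambda>x. 0) \<in> L2 \<Omega>"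
  by (simp add: L2_def)

lemma cmod_add_scaleR_square:
  "(cmod (a + c *\<^sub>R b))\<^sup>2 = (cmod a)\<^sup>2 + 2 * c * Re (b * cnj a) + c\<^sup>2 * (cmod b)\<^sup>2"
  unfolding cmod_power2 by (simp add: power2_eq_square algebra_simps)

text \<open>The expansion of the square has three integrable terms, the mixed one by
  \<open>integrable_mult_cnj\<close>.\<close>

lemma L2_add_scaleR:
  assumes u: "u \<in> L2 \<Omega>" and v: "v \<in> L2 \<Omega>"
  shows "(\<lambda>x. u x + c *\<^sub>R v x) \<in> L2 \<Omega>"
proof -
  have "integrable (lebesgue_on \<Omega>) (\<lambda>x. Re (v x * cnj (u x)))"
    using integrable_mult_cnj[OF v u] by (rule integrable_Re)
  then have "integrable (lebesgue_on \<Omega>) (\<lambda>x. (cmod (u x + c *\<^sub>R v x))\<^sup>2)"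
    unfolding cmod_add_scaleR_square using L2_D(2)[OF u] L2_D(2)[OF v]
    by (simp del: times_complex.sel)
  moreover have "(\<lambda>x. u x + c *\<^sub>R v x) \<in> borel_measurable (lebesgue_on \<Omega>)"
    using L2_D(1)[OF u] L2_D(1)[OF v] by (intro borel_measurable_add borel_measurable_scaleR) auto
  ultimately show ?thesis
    by (simp add: L2_def)
qed

lemma L2_scaleR: "u \<in> L2 \<Omega> \<Longrightarrow> (\<lambda>x. c *\<^sub>R u x) \<in> L2 \<Omega>"
  using L2_add_scaleR[OF L2_zero, of u \<Omega> c] by simp

lemma L2_add: "u \<in> L2 \<Omega> \<Longrightarrow> v \<in> L2 \<Omega> \<Longrightarrow> (\<lambda>x. u x + v x) \<in> L2 \<Omega>"
  using L2_add_scaleR[of u \<Omega> v 1] by simp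

lemma L2_sum:
  assumes "\<And>j. j \<in> J \<Longrightarrow> u j \<in> L2 \<Omega>"
  shows "(\<lambda>x. \<Sum>j\<in>J. u j x) \<in> L2 \<Omega>"
  using assms by (induction J rule: infinite_finite_induct) (auto simp: L2_zero intro: L2_add)

lemma inner_L2_sum_left:
  assumes "\<And>j. j \<in> J \<Longrightarrow> u j \<in> L2 \<Omega>" and "v \<in> L2 \<Omega>"
  shows "inner_L2 \<Omega> (\<lambda>x. \<Sum>j\<in>J. u j x) v = (\<Sum>j\<in>J. inner_L2 \<Omega> (u j) v)"
  unfolding inner_L2_def sum_distrib_right
  by (rule Bochner_Integration.integral_sum) (use assms in \<open>auto intro: integrable_mult_cnj\<close>)

lemma norm_L2_square: "(norm_L2 \<Omega> u)\<^sup>2 = (LINT x|lebesgue_on \<Omega>. (cmod (u x))\<^sup>2)"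
  by (simp add: norm_L2_def)

lemma norm_L2_add_scaleR_square:
  assumes u: "u \<in> L2 \<Omega>" and v: "v \<in> L2 \<Omega>"
  shows "(norm_L2 \<Omega> (\<lambda>x. u x + c *\<^sub>R v x))\<^sup>2
    = (norm_L2 \<Omega> u)\<^sup>2 + 2 * c * Re (inner_L2 \<Omega> v u) + c\<^sup>2 * (norm_L2 \<Omega> v)\<^sup>2"
proof -
  note int = L2_D(2)[OF u] L2_D(2)[OF v] integrable_mult_cnj[OF v u]
  have "Re (inner_L2 \<Omega> v u) = (LINT x|lebesgue_on \<Omega>. Re (v x * cnj (u x)))"
    unfolding inner_L2_def using int(3) by (rule integral_Re[symmetric])
  moreover have "integrable (lebesgue_on \<Omega>) (\<lambda>x. Re (v x * cnj (u x)))"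
    using int(3) by (rule integrable_Re)
  ultimately show ?thesis
    unfolding norm_L2_square cmod_add_scaleR_square using int(1,2)
    by (simp del: times_complex.sel)
qed

lemma norm_L2_square_eq_0_iff:
  assumes "u \<in> L2 \<Omega>"
  shows "(norm_L2 \<Omega> u)\<^sup>2 = 0 \<longleftrightarrow> eq_L2 \<Omega> u (\<lambda>x. 0)"
  unfolding norm_L2_square eq_L2_def
  using integral_nonneg_eq_0_iff_AE[OF L2_D(2)[OF assms]] by simp

text \<open>
  Lebesgue measure is complete, so a function that agrees almost everywhere with a measurable
  one is measurable. The update is only given up to null sets, and without its measurability
  its integral would be a meaningless default value.
\<close>

lemma borel_measurable_lebesgue_on_AE:
  fixes u v :: "'a::euclidean_space \<Rightarrow> 'b::euclidean_space"
  assumes \<Omega>: "\<Omega> \<in> sets lebesgue" and u: "u \<in> borel_measurable (lebesgue_on \<Omega>)"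
    and ae: "AE x in lebesgue_on \<Omega>. u x = v x"
  shows "v \<in> borel_measurable (lebesgue_on \<Omega>)"
proof -
  have "(\<lambda>x. if x \<in> \<Omega> then u x else 0) \<in> borel_measurable lebesgue"
    using u \<Omega> by (simp add: borel_measurable_if)
  moreover have "AE x in lebesgue. (if x \<in> \<Omega> then u x else 0) = (if x \<in> \<Omega> then v x else 0)"
    using ae \<Omega> by (auto simp: AE_restrict_space_iff elim: eventually_mono)
  ultimately have "(\<lambda>x. if x \<in> \<Omega> then v x else 0) \<in> borel_measurable lebesgue"
    by (rule borel_measurable_AE)
  then show ?thesis
    using \<Omega> by (simp add: borel_measurable_if)
qed

lemma norm_L2_cong:
  assumes \<Omega>: "\<Omega> \<in> sets lebesgue" and v: "v \<in> L2 \<Omega>" and eq: "eq_L2 \<Omega> u v"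
  shows "norm_L2 \<Omega> u = norm_L2 \<Omega> v"
proof -
  have ae: "AE x in lebesgue_on \<Omega>. u x = v x"
    using eq by (simp add: eq_L2_def)
  have "AE x in lebesgue_on \<Omega>. v x = u x"
    using ae by eventually_elim simp
  then have "u \<in> borel_measurable (lebesgue_on \<Omega>)"
    by (rule borel_measurable_lebesgue_on_AE[OF \<Omega> L2_D(1)[OF v]])
  then show ?thesis
    unfolding norm_L2_def using L2_D(1)[OF v] ae
    by (intro arg_cong[where f = sqrt] integral_cong_AE) (auto elim: eventually_mono)
qed

theorem theorem3p1:
  fixes \<Omega> :: "(real^'d::finite) set"
    and lam \<epsilon> \<tau> \<gamma> :: real
    and k s :: nat
    and aI aE :: "nat \<Rightarrow> nat \<Rightarrow> real"
    and bI bE :: "nat \<Rightarrow> real"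
    and un un1 G :: "real^'d \<Rightarrow> complex"
    and u gI gE :: "nat \<Rightarrow> real^'d \<Rightarrow> complex"
  assumes "smooth_bounded_domain \<Omega>"
    and "lam \<noteq> 0" and "0 < \<epsilon>" and "\<epsilon> < 1" and "2 \<le> k" and "0 < \<tau>" and "1 \<le> s"
    and "\<And>i j. \<lbrakk>i \<in> {1..s}; j \<in> {1..s}; j > i\<rbrakk> \<Longrightarrow> aI i j = 0"
    and "\<And>i j. \<lbrakk>i \<in> {1..s}; j \<in> {1..s}; j \<ge> i\<rbrakk> \<Longrightarrow> aE i j = 0"
    and "un \<in> L2 \<Omega>"
    and "\<And>i. i \<in> {1..s} \<Longrightarrow> u i \<in> L2 \<Omega> \<and> gI i \<in> L2 \<Omega> \<and> gE i \<in> L2 \<Omega>"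
    and "\<And>i. i \<in> {1..s} \<Longrightarrow> is_gI \<Omega> (u i) (gI i)"
    and "\<And>i. i \<in> {1..s} \<Longrightarrow> eq_L2 \<Omega> (gE i) (gE_fun lam \<epsilon> k (u i))"
    and "\<And>i. i \<in> {1..s} \<Longrightarrow>
           eq_L2 \<Omega> (u i)
             (\<lambda>x. un x + \<tau> *\<^sub>R (\<Sum>j=1..i. aI i j *\<^sub>R gI j x)
                       + \<tau> *\<^sub>R (\<Sum>j=1..i-1. aE i j *\<^sub>R gE j x))"
    and "eq_L2 \<Omega> un1
           (\<lambda>x. un x + (\<tau> * \<gamma>) *\<^sub>R (\<Sum>j=1..s. bI j *\<^sub>R gI j x)
                     + (\<tau> * \<gamma>) *\<^sub>R (\<Sum>j=1..s. bE j *\<^sub>R gE j x))"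
    and "G = (\<lambda>x. (\<Sum>j=1..s. bI j *\<^sub>R gI j x) + (\<Sum>j=1..s. bE j *\<^sub>R gE j x))"
    and "\<gamma> = (if eq_L2 \<Omega> G (\<lambda>x. 0) then 1
              else - 2 * (\<Sum>j=1..s. Re (inner_L2 \<Omega> (\<lambda>x. bI j *\<^sub>R gI j x + bE j *\<^sub>R gE j x) un))
                   / (\<tau> * (norm_L2 \<Omega> G)\<^sup>2))"
  shows "(norm_L2 \<Omega> un1)\<^sup>2 = (norm_L2 \<Omega> un)\<^sup>2"
proof -
  note domain = assms(1) and un = assms(10) and stages = assms(11) and update = assms(15)
    and G = assms(16) and relax = assms(17)
  define S where "S = Re (inner_L2 \<Omega> G un)"
  define N where "N = (norm_L2 \<Omega> G)\<^sup>2"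
  define c where "c = \<tau> * \<gamma>"
  have \<Omega>: "\<Omega> \<in> sets lebesgue"
    using domain by (simp add: smooth_bounded_domain_def)
  have increment_L2: "(\<lambda>x. bI j *\<^sub>R gI j x + bE j *\<^sub>R gE j x) \<in> L2 \<Omega>" if "j \<in> {1..s}" for j
    using stages[OF that] by (intro L2_add L2_scaleR) auto
  have G_eq: "G = (\<lambda>x. \<Sum>j=1..s. bI j *\<^sub>R gI j x + bE j *\<^sub>R gE j x)"
    by (simp add: G sum.distrib)
  have G_L2: "G \<in> L2 \<Omega>"
    unfolding G_eq using increment_L2 by (rule L2_sum)
  have S_eq: "S = (\<Sum>j=1..s. Re (inner_L2 \<Omega> (\<lambda>x. bI j *\<^sub>R gI j x + bE j *\<^sub>R gE j x) un))"
    unfolding S_def G_eq using increment_L2 un by (subst inner_L2_sum_left) auto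
  have "eq_L2 \<Omega> un1 (\<lambda>x. un x + c *\<^sub>R G x)"
    using update by (simp add: G c_def scaleR_add_right add.assoc)
  then have "norm_L2 \<Omega> un1 = norm_L2 \<Omega> (\<lambda>x. un x + c *\<^sub>R G x)"
    using \<Omega> L2_add_scaleR[OF un G_L2] by (intro norm_L2_cong)
  then have mass: "(norm_L2 \<Omega> un1)\<^sup>2 = (norm_L2 \<Omega> un)\<^sup>2 + 2 * c * S + c\<^sup>2 * N"
    by (simp add: norm_L2_add_scaleR_square[OF un G_L2] S_def N_def)
  show ?thesis
  proof (cases "eq_L2 \<Omega> G (\<lambda>x. 0)")
    case True
    \<comment> \<open>Both \<open>N\<close> and \<open>S\<close> vanish with \<open>G\<close>, so the mass is unchanged whatever \<open>c\<close> is.\<close>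
    then have "N = 0"
      using norm_L2_square_eq_0_iff[OF G_L2] by (simp add: N_def)
    moreover have "S = 0"
    proof -
      have "AE x in lebesgue_on \<Omega>. G x * cnj (un x) = 0"
        using True unfolding eq_L2_def by eventually_elim simp
      then show ?thesis
        unfolding S_def inner_L2_def by (simp only: integral_eq_zero_AE zero_complex.sel)
    qed
    ultimately show ?thesis
      using mass by simp
  next
    case False
    then have "N \<noteq> 0"
      using norm_L2_square_eq_0_iff[OF G_L2] by (simp add: N_def)
    moreover have "c = - 2 * S / N"
      using relax False \<open>0 < \<tau>\<close> by (simp add: c_def S_eq N_def)
    ultimately have "2 * c * S + c\<^sup>2 * N = 0"
      by (simp add: power2_eq_square)
    then show ?thesis
      using mass by linarith
  qed
qed

end
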